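(* Let $(A,\mathcal{C})$ be a crossed monoid over a small category $\mathcal{C}$. The sequence of sets $N_n(A,\mathcal{C})$, $n\ge 0$, together with the maps $d_j\colon N_n(A,\mathcal{C})\to N_{n-1}(A,\mathcal{C})$ ($n\ge 1$) and $s_j\colon N_n(A,\mathcal{C})\to N_{n+1}(A,\mathcal{C})$ ($n\ge 0$), $0\le j\le n$, defined in the context, is a simplicial set.
   Context: Crossed monoids. $\mathcal{C}$ is a small category with object set $\mathcal{C}_0$ and morphism set $\mathcal{C}_1$; $\mathcal{C}(s,t)$ is the set of morphisms with source $s$ and target $t$, and $\alpha\beta$ means $\alpha$ after $\beta$. A crossed monoid $(A,\mathcal{C})$ over $\mathcal{C}$ is a contravariant functor $A$ from $\mathcal{C}$ to the category of monoids (for $\alpha\in\mathcal{C}(s,t)$ and $a\in A(t)$ write $a^\alpha:=A(\alpha)(a)\in A(s)$) together with monoid homomorphisms $\partial_t\colon A(t)\to\mathcal{C}(t,t)$, $t\in\mathcal{C}_0$, such that $\alpha\,\partial_s(a^\alpha)=\partial_t(a)\,\alpha$ and $ab=b\,a^{\partial_t b}$ for all $s,t\in\mathcal{C}_0$, $\alpha\in\mathcal{C}(s,t)$, $a,b\in A(t)$. The unit of $A(x)$ is $e_x$, the identity of $x$ is $1_x$; write $\partial$ for $\partial_t$. Nerve. $N_0(A,\mathcal{C})=\mathcal{C}_0$. For $n\ge1$, $N_n(A,\mathcal{C})$ is the set of $n\times n$ upper triangular matrices $M=(m_{ij})_{1\le i\le j\le n}$ (entries below the diagonal are absent) for which there is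 a sequence $(x_0,\dots,x_n)$ of objects of $\mathcal{C}$ with $m_{jj}\in\mathcal{C}(x_j,x_{j-1})$ for $1\le j\le n$ and $m_{ij}\in A(x_i)$ for $1\le i<j\le n$. Thus $N_1(A,\mathcal{C})=\mathcal{C}_1$. Degeneracies: $s_0\colon N_0\to N_1$ is $p\mapsto 1_p$. For $n\ge1$, $M\in N_n$, $0\le j\le n$, $s_j(M)=M'\in N_{n+1}$ with: for $i\le j$: $m'_{ik}=m_{ik}$ if $k\le j$, $m'_{i,j+1}=e_{x_i}$, $m'_{ik}=m_{i,k-1}$ if $k>j+1$; $m'_{j+1,j+1}=1_{x_j}$ and $m'_{j+1,k}=e_{x_j}$ for $k>j+1$; for $i>j+1$: $m'_{ik}=m_{i-1,k-1}$. Faces: on $N_1$, $d_0$ is the source map and $d_1$ the target map. For $n\ge2$, $M\in N_n$, $d_j(M)=M'\in N_{n-1}$ with: for $j=0$: $m'_{ik}=m_{i+1,k+1}$; for $j=n$: $m'_{ik}=m_{ik}$; for $1\le j\le n-1$: if $i<j$ then $m'_{ik}=m_{ik}$ for $k<j$, $m'_{ij}=m_{ij}m_{i,j+1}$, $m'_{ik}=m_{i,k+1}$ for $k>j$; $m'_{jj}=m_{jj}\,\partial(m_{j,j+1})\,m_{j+1,j+1}$; $m'_{jk}=(m_{j,k+1})^{\eta_k}\,m_{j+1,k+1}$ for $k>j$, where $\eta_k=m_{j+1,j+1}\,\partial(m_{j+1,j+2}\cdots m_{j+1,k})$ (empty product being the unit, so $\eta_{j+1}=m_{j+1,j+1}$);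 and $m'_{ik}=m_{i+1,k+1}$ for $i>j$. *)

theory Defs
  imports "HOL-Algebra.Group"
begin

section \<open>Small categories\<close>

text \<open>\<open>Comp C \<alpha> \<beta>\<close> is \<open>\<alpha>\<close> after \<open>\<beta>\<close>; it is only meaningful if the source of \<open>\<alpha>\<close> is the
  target of \<open>\<beta>\<close>.\<close>

record ('o, 'm) category_data =
  Obj :: "'o set"
  Arr :: "'m set"
  Source :: "'m \<Rightarrow> 'o"
  Target :: "'m \<Rightarrow> 'o"
  Ident :: "'o \<Rightarrow> 'm"
  Comp :: "'m \<Rightarrow> 'm \<Rightarrow> 'm"

definition Hom :: "('o, 'm) category_data \<Rightarrow> 'o \<Rightarrow> 'o \<Rightarrow> 'm set" where
  "Hom C s t = {\<alpha> \<in> Arr C. Source C \<alpha> = s \<and> Target C \<alpha> = t}"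

locale small_category =
  fixes C :: "('o, 'm) category_data"
  assumes Source_in: "\<alpha> \<in> Arr C \<Longrightarrow> Source C \<alpha> \<in> Obj C"
    and Target_in: "\<alpha> \<in> Arr C \<Longrightarrow> Target C \<alpha> \<in> Obj C"
    and Ident_in: "x \<in> Obj C \<Longrightarrow> Ident C x \<in> Hom C x x"
    and Comp_in: "\<lbrakk>\<alpha> \<in> Hom C s t; \<beta> \<in> Hom C r s\<rbrakk> \<Longrightarrow> Comp C \<alpha> \<beta> \<in> Hom C r t"
    and Comp_Ident: "\<alpha> \<in> Hom C s t \<Longrightarrow> Comp C \<alpha> (Ident C s) = \<alpha>"
    and Ident_Comp: "\<alpha> \<in> Hom C s t \<Longrightarrow> Comp C (Ident C t) \<alpha> = \<alpha>"
    and Comp_assoc: "\<lbrakk>\<alpha> \<in> Hom C s t; \<beta> \<in> Hom C r s; \<gamma> \<in> Hom C q r\<rbrakk>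
      \<Longrightarrow> Comp C (Comp C \<alpha> \<beta>) \<gamma> = Comp C \<alpha> (Comp C \<beta> \<gamma>)"

definition End :: "('o, 'm) category_data \<Rightarrow> 'o \<Rightarrow> 'm monoid" where
  "End C t = \<lparr>carrier = Hom C t t, mult = Comp C, one = Ident C t\<rparr>"


section \<open>Crossed monoids\<close>

text \<open>\<^const>\<open>hom\<close> only asks for compatibility with multiplication.\<close>

definition monoid_hom :: "('a, 'c) monoid_scheme \<Rightarrow> ('b, 'd) monoid_scheme \<Rightarrow> ('a \<Rightarrow> 'b) set" where
  "monoid_hom G H = {h \<in> hom G H. h \<one>\<^bsub>G\<^esub> = \<one>\<^bsub>H\<^esub>}"

text \<open>\<open>pull \<alpha> a\<close> is \<open>a\<^sup>\<alpha>\<close>. The monoids \<open>A x\<close> have their carriers in one common type \<open>'a\<close>, which is no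
  restriction for a family indexed by a set of objects; the carriers may overlap.\<close>

locale crossed_monoid = small_category C
  for C :: "('o, 'm) category_data" +
  fixes A :: "'o \<Rightarrow> 'a monoid"
    and pull :: "'m \<Rightarrow> 'a \<Rightarrow> 'a"
    and bd :: "'o \<Rightarrow> 'a \<Rightarrow> 'm"
  assumes monoid_A: "x \<in> Obj C \<Longrightarrow> monoid (A x)"
    and pull_hom: "\<alpha> \<in> Hom C s t \<Longrightarrow> pull \<alpha> \<in> monoid_hom (A t) (A s)"
    and pull_Ident: "\<lbrakk>t \<in> Obj C; a \<in> carrier (A t)\<rbrakk> \<Longrightarrow> pull (Ident C t) a = a"
    and pull_Comp: "\<lbrakk>\<alpha> \<in> Hom C s t; \<beta> \<in> Hom C r s; a \<in> carrier (A t)\<rbrakk>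
      \<Longrightarrow> pull (Comp C \<alpha> \<beta>) a = pull \<beta> (pull \<alpha> a)"
    and bd_hom: "t \<in> Obj C \<Longrightarrow> bd t \<in> monoid_hom (A t) (End C t)"
    and bd_pull: "\<lbrakk>\<alpha> \<in> Hom C s t; a \<in> carrier (A t)\<rbrakk>
      \<Longrightarrow> Comp C \<alpha> (bd s (pull \<alpha> a)) = Comp C (bd t a) \<alpha>"
    and crossed: "\<lbrakk>t \<in> Obj C; a \<in> carrier (A t); b \<in> carrier (A t)\<rbrakk>
      \<Longrightarrow> a \<otimes>\<^bsub>A t\<^esub> b = b \<otimes>\<^bsub>A t\<^esub> pull (bd t b) a"


section \<open>The nerve of a crossed monoid\<close>

datatype ('m, 'a) entry = Absent | Mor (mor: 'm) | Elt (elt: 'a)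

type_synonym ('m, 'a) matrix = "nat \<Rightarrow> nat \<Rightarrow> ('m, 'a) entry"

text \<open>A matrix does not carry its size; in \<open>nerve C A n\<close> every entry outside \<open>1 \<le> i \<le> j \<le> n\<close> is
  \<open>Absent\<close>, so that equality in the type is equality of matrices.\<close>

datatype ('o, 'm, 'a) simplex = Vertex (vertex: 'o) | Matrix (entries: "('m, 'a) matrix")

definition upper_triangular :: "nat \<Rightarrow> ('m, 'a) matrix \<Rightarrow> ('m, 'a) matrix" where
  "upper_triangular n m = (\<lambda>i j. if 1 \<le> i \<and> i \<le> j \<and> j \<le> n then m i j else Absent)"

definition nerve_matrices ::
    "('o, 'm) category_data \<Rightarrow> ('o \<Rightarrow> 'a monoid) \<Rightarrow> nat \<Rightarrow> ('m, 'a) matrix set" where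
  "nerve_matrices C A n = {m.
     (\<forall>i j. \<not> (1 \<le> i \<and> i \<le> j \<and> j \<le> n) \<longrightarrow> m i j = Absent) \<and>
     (\<exists>x. (\<forall>j\<le>n. x j \<in> Obj C) \<and>
          (\<forall>j. 1 \<le> j \<and> j \<le> n \<longrightarrow> m j j \<in> Mor ` Hom C (x j) (x (j - 1))) \<and>
          (\<forall>i j. 1 \<le> i \<and> i < j \<and> j \<le> n \<longrightarrow> m i j \<in> Elt ` carrier (A (x i))))}"

definition nerve ::
    "('o, 'm) category_data \<Rightarrow> ('o \<Rightarrow> 'a monoid) \<Rightarrow> nat \<Rightarrow> ('o, 'm, 'a) simplex set" where
  "nerve C A n = (if n = 0 then Vertex ` Obj C else Matrix ` nerve_matrices C A n)"

text \<open>For \<open>n \<ge> 1\<close> the objects \<open>x\<^sub>0, \<dots>, x\<^sub>n\<close> are determined by the diagonal of the matrix.\<close>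

definition vert :: "('o, 'm) category_data \<Rightarrow> ('m, 'a) matrix \<Rightarrow> nat \<Rightarrow> 'o" where
  "vert C m i = (if i = 0 then Target C (mor (m 1 1)) else Source C (mor (m i i)))"

definition degen_matrix ::
    "('o, 'm) category_data \<Rightarrow> ('o \<Rightarrow> 'a monoid) \<Rightarrow> nat \<Rightarrow> nat \<Rightarrow> ('m, 'a) matrix \<Rightarrow> ('m, 'a) matrix" where
  "degen_matrix C A n j m = upper_triangular (n + 1) (\<lambda>i k.
     if i \<le> j then
       (if k \<le> j then m i k
        else if k = j + 1 then Elt \<one>\<^bsub>A (vert C m i)\<^esub>
        else m i (k - 1))
     else if i = j + 1 then
       (if k = j + 1 then Mor (Ident C (vert C m j)) else Elt \<one>\<^bsub>A (vert C m j)\<^esub>)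
     else m (i - 1) (k - 1))"

definition degen ::
    "('o, 'm) category_data \<Rightarrow> ('o \<Rightarrow> 'a monoid) \<Rightarrow> nat \<Rightarrow> nat
      \<Rightarrow> ('o, 'm, 'a) simplex \<Rightarrow> ('o, 'm, 'a) simplex" where
  "degen C A n j X =
     (if n = 0 then Matrix (upper_triangular 1 (\<lambda>i k. Mor (Ident C (vertex X))))
      else Matrix (degen_matrix C A n j (entries X)))"

text \<open>\<open>eta C A bd m j k\<close> is
  \<open>\<eta>\<^sub>k = m\<^bsub>j+1,j+1\<^esub> \<partial>(m\<^bsub>j+1,j+2\<^esub> \<cdots> m\<^bsub>j+1,k\<^esub>)\<close>, a morphism from \<open>x\<^bsub>j+1\<^esub>\<close> to \<open>x\<^sub>j\<close>.\<close>

definition eta ::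
    "('o, 'm) category_data \<Rightarrow> ('o \<Rightarrow> 'a monoid) \<Rightarrow> ('o \<Rightarrow> 'a \<Rightarrow> 'm)
      \<Rightarrow> ('m, 'a) matrix \<Rightarrow> nat \<Rightarrow> nat \<Rightarrow> 'm" where
  "eta C A bd m j k =
     (let x = vert C m (j + 1) in
      Comp C (mor (m (j + 1) (j + 1)))
        (bd x (foldr (\<otimes>\<^bsub>A x\<^esub>) (map (\<lambda>l. elt (m (j + 1) l)) [j + 2..<k + 1]) \<one>\<^bsub>A x\<^esub>)))"

definition face_matrix ::
    "('o, 'm) category_data \<Rightarrow> ('o \<Rightarrow> 'a monoid) \<Rightarrow> ('m \<Rightarrow> 'a \<Rightarrow> 'a) \<Rightarrow> ('o \<Rightarrow> 'a \<Rightarrow> 'm)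
      \<Rightarrow> nat \<Rightarrow> nat \<Rightarrow> ('m, 'a) matrix \<Rightarrow> ('m, 'a) matrix" where
  "face_matrix C A pull bd n j m = upper_triangular (n - 1) (\<lambda>i k.
     if j = 0 then m (i + 1) (k + 1)
     else if j = n then m i k
     else if i < j then
       (if k < j then m i k
        else if k = j then Elt (elt (m i j) \<otimes>\<^bsub>A (vert C m i)\<^esub> elt (m i (j + 1)))
        else m i (k + 1))
     else if i = j then
       (if k = j then
          Mor (Comp C (Comp C (mor (m j j)) (bd (vert C m j) (elt (m j (j + 1)))))
                 (mor (m (j + 1) (j + 1))))
        else Elt (pull (eta C A bd m j k) (elt (m j (k + 1)))
                    \<otimes>\<^bsub>A (vert C m (j + 1))\<^esub> elt (m (j + 1) (k + 1))))
     else m (i + 1) (k + 1))"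

definition face ::
    "('o, 'm) category_data \<Rightarrow> ('o \<Rightarrow> 'a monoid) \<Rightarrow> ('m \<Rightarrow> 'a \<Rightarrow> 'a) \<Rightarrow> ('o \<Rightarrow> 'a \<Rightarrow> 'm)
      \<Rightarrow> nat \<Rightarrow> nat \<Rightarrow> ('o, 'm, 'a) simplex \<Rightarrow> ('o, 'm, 'a) simplex" where
  "face C A pull bd n j X =
     (if n = 1 then
        Vertex (if j = 0 then Source C (mor (entries X 1 1)) else Target C (mor (entries X 1 1)))
      else Matrix (face_matrix C A pull bd n j (entries X)))"


section \<open>Simplicial sets\<close>

text \<open>\<open>d n j\<close> and \<open>s n j\<close> are the face and degeneracy operators defined on \<open>X n\<close>.\<close>

locale simplicial_set =
  fixes X :: "nat \<Rightarrow> 'x set"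
    and d :: "nat \<Rightarrow> nat \<Rightarrow> 'x \<Rightarrow> 'x"
    and s :: "nat \<Rightarrow> nat \<Rightarrow> 'x \<Rightarrow> 'x"
  assumes d_in: "\<lbrakk>1 \<le> n; j \<le> n; x \<in> X n\<rbrakk> \<Longrightarrow> d n j x \<in> X (n - 1)"
    and s_in: "\<lbrakk>j \<le> n; x \<in> X n\<rbrakk> \<Longrightarrow> s n j x \<in> X (n + 1)"
    and d_d: "\<lbrakk>2 \<le> n; i < j; j \<le> n; x \<in> X n\<rbrakk>
      \<Longrightarrow> d (n - 1) i (d n j x) = d (n - 1) (j - 1) (d n i x)"
    and d_s_less: "\<lbrakk>i < j; j \<le> n; x \<in> X n\<rbrakk>
      \<Longrightarrow> d (n + 1) i (s n j x) = s (n - 1) (j - 1) (d n i x)"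
    and d_s_same: "\<lbrakk>j \<le> n; x \<in> X n\<rbrakk> \<Longrightarrow> d (n + 1) j (s n j x) = x"
    and d_s_Suc: "\<lbrakk>j \<le> n; x \<in> X n\<rbrakk> \<Longrightarrow> d (n + 1) (j + 1) (s n j x) = x"
    and d_s_greater: "\<lbrakk>j + 1 < i; i \<le> n + 1; x \<in> X n\<rbrakk>
      \<Longrightarrow> d (n + 1) i (s n j x) = s (n - 1) j (d n (i - 1) x)"
    and s_s: "\<lbrakk>i \<le> j; j \<le> n; x \<in> X n\<rbrakk>
      \<Longrightarrow> s (n + 1) i (s n j x) = s (n + 1) (j + 1) (s n i x)"

end

theory Submission
  imports Defs
begin

text \<open>
  A crossed monoid is a strict 2-category in disguise. Its 1-cells are the morphisms of \<open>C\<close>; for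
  \<open>\<alpha> \<in> Hom C s t\<close>, an element \<open>a\<close> of \<open>A s\<close> is a 2-cell from \<open>\<alpha>\<close> to
  \<open>\<alpha> \<partial>(a)\<close>. Vertical composition is multiplication in \<open>A s\<close>, and the horizontal composite of
  \<open>a\<close> on \<open>\<alpha>\<close> with \<open>b\<close> on \<open>\<beta>\<close> is \<open>a\<^sup>\<beta> b\<close>. The axiom on \<open>\<partial>(a\<^sup>\<alpha>)\<close> says that
  this composite has the right target (lemma \<open>hcomp_target\<close>), and the axiom on \<open>ab\<close> gives the interchange
  law (lemma \<open>interchange\<close>).

  Row \<open>i\<close> of a matrix in the nerve is then a chain of 2-cells between 1-cells \<open>x\<^sub>i \<rightarrow> x\<^bsub>i-1\<^esub>\<close>:
  it starts at \<open>m\<^bsub>ii\<^esub>\<close>, and \<open>m\<^bsub>ik\<^esub>\<close> leads from its stage \<open>k-1\<close> to its stage \<open>k\<close>.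
  Composing horizontally the rows \<open>i+1, \<dots>, j\<close>, at a stage \<open>k \<ge> j\<close> at which all of them are
  defined, yields a 1-cell \<open>F i j k\<close> from \<open>x\<^sub>j\<close> to \<open>x\<^sub>i\<close>, and between the stages \<open>k\<close> and
  \<open>l\<close> a 2-cell \<open>E i j k l\<close>. The matrix is thereby a fragment of a strict functor, a
  \<open>pasting_family\<close>, and it can be read off from that functor.

  The index set of such a functor is the ordinal \<open>{0, \<dots>, n}\<close>, and it can be reindexed along every
  monotone map (lemma \<open>reindex\<close>). The formulas for the face and degeneracy operators are exactly what
  reindexing along the coface and codegeneracy maps does to the matrix: the merged row of an inner face
  is a horizontal composite, and \<open>\<eta>\<^sub>k\<close> is the 1-cell \<open>F j (j + 1) k\<close> on which its second
  factor starts (lemmas \<open>face_simplex_of\<close>, \<open>degen_simplex_of\<close>). As every simplex arises from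
  a pasting family (lemma \<open>nerve_cases\<close>), the simplicial identities reduce to the cosimplicial
  identities between maps of natural numbers.
\<close>


section \<open>Calculus in a crossed monoid\<close>

context crossed_monoid
begin

lemma Hom_Obj:
  assumes "\<alpha> \<in> Hom C s t"
  shows "s \<in> Obj C" and "t \<in> Obj C"
  using assms Source_in Target_in by (auto simp: Hom_def)

lemma one_closed: "t \<in> Obj C \<Longrightarrow> \<one>\<^bsub>A t\<^esub> \<in> carrier (A t)"
  by (rule monoid.one_closed[OF monoid_A])

lemma mult_closed:
  "\<lbrakk>t \<in> Obj C; a \<in> carrier (A t); b \<in> carrier (A t)\<rbrakk> \<Longrightarrow> a \<otimes>\<^bsub>A t\<^esub> b \<in> carrier (A t)"
  by (rule monoid.m_closed[OF monoid_A])

lemma mult_assoc: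
  "\<lbrakk>t \<in> Obj C; a \<in> carrier (A t); b \<in> carrier (A t); c \<in> carrier (A t)\<rbrakk>
    \<Longrightarrow> a \<otimes>\<^bsub>A t\<^esub> b \<otimes>\<^bsub>A t\<^esub> c = a \<otimes>\<^bsub>A t\<^esub> (b \<otimes>\<^bsub>A t\<^esub> c)"
  by (rule monoid.m_assoc[OF monoid_A])

lemma one_mult: "\<lbrakk>t \<in> Obj C; a \<in> carrier (A t)\<rbrakk> \<Longrightarrow> \<one>\<^bsub>A t\<^esub> \<otimes>\<^bsub>A t\<^esub> a = a"
  by (rule monoid.l_one[OF monoid_A])

lemma mult_one: "\<lbrakk>t \<in> Obj C; a \<in> carrier (A t)\<rbrakk> \<Longrightarrow> a \<otimes>\<^bsub>A t\<^esub> \<one>\<^bsub>A t\<^esub> = a"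
  by (rule monoid.r_one[OF monoid_A])

lemma pull_closed: "\<lbrakk>\<alpha> \<in> Hom C s t; a \<in> carrier (A t)\<rbrakk> \<Longrightarrow> pull \<alpha> a \<in> carrier (A s)"
  using pull_hom by (fastforce simp: monoid_hom_def hom_def)

lemma pull_mult:
  "\<lbrakk>\<alpha> \<in> Hom C s t; a \<in> carrier (A t); b \<in> carrier (A t)\<rbrakk>
    \<Longrightarrow> pull \<alpha> (a \<otimes>\<^bsub>A t\<^esub> b) = pull \<alpha> a \<otimes>\<^bsub>A s\<^esub> pull \<alpha> b"
  using pull_hom by (fastforce simp: monoid_hom_def hom_def)

lemma pull_one: "\<alpha> \<in> Hom C s t \<Longrightarrow> pull \<alpha> \<one>\<^bsub>A t\<^esub> = \<one>\<^bsub>A s\<^esub>"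
  using pull_hom by (fastforce simp: monoid_hom_def)

lemma bd_closed: "\<lbrakk>t \<in> Obj C; a \<in> carrier (A t)\<rbrakk> \<Longrightarrow> bd t a \<in> Hom C t t"
  using bd_hom by (fastforce simp: monoid_hom_def hom_def End_def)

lemma bd_mult:
  "\<lbrakk>t \<in> Obj C; a \<in> carrier (A t); b \<in> carrier (A t)\<rbrakk>
    \<Longrightarrow> bd t (a \<otimes>\<^bsub>A t\<^esub> b) = Comp C (bd t a) (bd t b)"
  using bd_hom by (fastforce simp: monoid_hom_def hom_def End_def)

lemma bd_one: "t \<in> Obj C \<Longrightarrow> bd t \<one>\<^bsub>A t\<^esub> = Ident C t"
  using bd_hom by (fastforce simp: monoid_hom_def End_def)

text \<open>Compatibility of \<open>\<partial>\<close> with the action makes \<open>a\<^sup>\<beta> b\<close> the horizontal composite of the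
  2-cells \<open>a\<close> on \<open>\<alpha>\<close> and \<open>b\<close> on \<open>\<beta>\<close>: moving \<open>\<partial>(a)\<close> to the right past \<open>\<beta>\<close> turns
  \<open>a\<close> into \<open>a\<^sup>\<beta>\<close>.\<close>

lemma hcomp_target:
  assumes \<alpha>: "\<alpha> \<in> Hom C s t" and \<beta>: "\<beta> \<in> Hom C r s"
    and a: "a \<in> carrier (A s)" and b: "b \<in> carrier (A r)"
  shows "Comp C (Comp C \<alpha> (bd s a)) (Comp C \<beta> (bd r b))
    = Comp C (Comp C \<alpha> \<beta>) (bd r (pull \<beta> a \<otimes>\<^bsub>A r\<^esub> b))"
proof -
  have r: "r \<in> Obj C" and s: "s \<in> Obj C"
    using Hom_Obj \<beta> by auto
  note p = bd_closed[OF s a] and q = bd_closed[OF r b] and p' = bd_closed[OF r pull_closed[OF \<beta> a]]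
  have "Comp C (Comp C \<alpha> (bd s a)) (Comp C \<beta> (bd r b))
      = Comp C \<alpha> (Comp C (Comp C (bd s a) \<beta>) (bd r b))"
    by (simp only: Comp_assoc[OF \<alpha> p Comp_in[OF \<beta> q]] Comp_assoc[OF p \<beta> q])
  also have "\<dots> = Comp C \<alpha> (Comp C (Comp C \<beta> (bd r (pull \<beta> a))) (bd r b))"
    by (simp only: bd_pull[OF \<beta> a])
  also have "\<dots> = Comp C (Comp C \<alpha> \<beta>) (Comp C (bd r (pull \<beta> a)) (bd r b))"
    by (simp only: Comp_assoc[OF \<beta> p' q] Comp_assoc[OF \<alpha> \<beta> Comp_in[OF p' q]])
  finally show ?thesis
    by (simp add: bd_mult[OF r pull_closed[OF \<beta> a] b])
qed

text \<open>The interchange law. The second horizontal composite starts on \<open>\<beta> \<partial>(b)\<close>, so that \<open>a'\<close> enters as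
  \<open>v\<^bsup>\<partial> b\<^esup>\<close> with \<open>v = a'\<^sup>\<beta>\<close>; the crossed law \<open>v b = b v\<^bsup>\<partial> b\<^esup>\<close> moves \<open>v\<close> in front of
  \<open>b\<close>, where it meets \<open>a\<^sup>\<beta>\<close>.\<close>

lemma interchange:
  assumes \<beta>: "\<beta> \<in> Hom C r s"
    and a: "a \<in> carrier (A s)" "a' \<in> carrier (A s)"
    and b: "b \<in> carrier (A r)" "b' \<in> carrier (A r)"
  shows "(pull \<beta> a \<otimes>\<^bsub>A r\<^esub> b) \<otimes>\<^bsub>A r\<^esub> (pull (Comp C \<beta> (bd r b)) a' \<otimes>\<^bsub>A r\<^esub> b')
    = pull \<beta> (a \<otimes>\<^bsub>A s\<^esub> a') \<otimes>\<^bsub>A r\<^esub> (b \<otimes>\<^bsub>A r\<^esub> b')"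
proof -
  have r: "r \<in> Obj C"
    using Hom_Obj \<beta> by auto
  define u where "u = pull \<beta> a"
  define v where "v = pull \<beta> a'"
  have u: "u \<in> carrier (A r)" and v: "v \<in> carrier (A r)"
    using pull_closed \<beta> a by (auto simp: u_def v_def)
  have vb: "pull (bd r b) v \<in> carrier (A r)"
    using pull_closed[OF bd_closed[OF r b(1)] v] .
  have "b \<otimes>\<^bsub>A r\<^esub> (pull (Comp C \<beta> (bd r b)) a' \<otimes>\<^bsub>A r\<^esub> b') = v \<otimes>\<^bsub>A r\<^esub> (b \<otimes>\<^bsub>A r\<^esub> b')"
    using crossed[OF r v b(1)] pull_Comp[OF \<beta> bd_closed[OF r b(1)] a(2)]
      mult_assoc[OF r] b v vb by (metis v_def)
  moreover have "pull (Comp C \<beta> (bd r b)) a' \<in> carrier (A r)"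
    using pull_closed Comp_in[OF \<beta> bd_closed[OF r b(1)]] a(2) by blast
  ultimately show ?thesis
    using u v b by (simp add: pull_mult[OF \<beta> a] u_def[symmetric] v_def[symmetric]
        mult_assoc[OF r] mult_closed[OF r])
qed

end


section \<open>Simplices as strict functors\<close>

text \<open>\<open>F i j k\<close> is the composite 1-cell from \<open>x j\<close> to \<open>x i\<close> at stage \<open>k\<close>, and \<open>E i j k l\<close> the
  2-cell from \<open>F i j k\<close> to \<open>F i j l\<close>. The indices satisfy \<open>i \<le> j \<le> k \<le> l\<close> because row \<open>j\<close>
  of a triangular matrix begins at stage \<open>j\<close>. The axioms state strict functoriality for both
  compositions; their hypotheses concern only the order of the indices and the bound \<open>n\<close>, which
  is why monotone reindexing preserves them.\<close>

locale pasting_family = crossed_monoid C A pull bd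
  for C :: "('o, 'm) category_data" and A :: "'o \<Rightarrow> 'a monoid"
    and pull :: "'m \<Rightarrow> 'a \<Rightarrow> 'a" and bd :: "'o \<Rightarrow> 'a \<Rightarrow> 'm" +
  fixes n :: nat and x :: "nat \<Rightarrow> 'o" and F :: "nat \<Rightarrow> nat \<Rightarrow> nat \<Rightarrow> 'm"
    and E :: "nat \<Rightarrow> nat \<Rightarrow> nat \<Rightarrow> nat \<Rightarrow> 'a"
  assumes obj: "i \<le> n \<Longrightarrow> x i \<in> Obj C"
    and F_in: "\<lbrakk>i \<le> j; j \<le> k; k \<le> n\<rbrakk> \<Longrightarrow> F i j k \<in> Hom C (x j) (x i)"
    and F_Ident: "\<lbrakk>i \<le> k; k \<le> n\<rbrakk> \<Longrightarrow> F i i k = Ident C (x i)"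
    and F_Comp: "\<lbrakk>i \<le> j; j \<le> h; h \<le> k; k \<le> n\<rbrakk> \<Longrightarrow> F i h k = Comp C (F i j k) (F j h k)"
    and E_in: "\<lbrakk>i \<le> j; j \<le> k; k \<le> l; l \<le> n\<rbrakk> \<Longrightarrow> E i j k l \<in> carrier (A (x j))"
    and E_one: "\<lbrakk>i \<le> j; j \<le> k; k \<le> n\<rbrakk> \<Longrightarrow> E i j k k = \<one>\<^bsub>A (x j)\<^esub>"
    and E_vcomp: "\<lbrakk>i \<le> j; j \<le> k; k \<le> l; l \<le> r; r \<le> n\<rbrakk>
      \<Longrightarrow> E i j k r = E i j k l \<otimes>\<^bsub>A (x j)\<^esub> E i j l r"
    and E_target: "\<lbrakk>i \<le> j; j \<le> k; k \<le> l; l \<le> n\<rbrakk>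
      \<Longrightarrow> F i j l = Comp C (F i j k) (bd (x j) (E i j k l))"
    and E_Ident: "\<lbrakk>i \<le> k; k \<le> l; l \<le> n\<rbrakk> \<Longrightarrow> E i i k l = \<one>\<^bsub>A (x i)\<^esub>"
    and E_hcomp: "\<lbrakk>i \<le> j; j \<le> h; h \<le> k; k \<le> l; l \<le> n\<rbrakk>
      \<Longrightarrow> E i h k l = pull (F j h k) (E i j k l) \<otimes>\<^bsub>A (x h)\<^esub> E j h k l"

text \<open>A row is a horizontal step of length one, an entry in it a vertical step of length one.\<close>

definition matrix_of ::
    "nat \<Rightarrow> (nat \<Rightarrow> nat \<Rightarrow> nat \<Rightarrow> 'm) \<Rightarrow> (nat \<Rightarrow> nat \<Rightarrow> nat \<Rightarrow> nat \<Rightarrow> 'a) \<Rightarrow> ('m, 'a) matrix" where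
  "matrix_of n F E = upper_triangular n
     (\<lambda>i k. if i = k then Mor (F (i - 1) i i) else Elt (E (i - 1) i (k - 1) k))"

lemma matrix_of_entry:
  assumes "1 \<le> i" and "i \<le> k" and "k \<le> n"
  shows "matrix_of n F E i k = (if i = k then Mor (F (i - 1) i i) else Elt (E (i - 1) i (k - 1) k))"
  using assms by (simp add: matrix_of_def upper_triangular_def)

definition simplex_of ::
    "nat \<Rightarrow> (nat \<Rightarrow> 'o) \<Rightarrow> (nat \<Rightarrow> nat \<Rightarrow> nat \<Rightarrow> 'm) \<Rightarrow> (nat \<Rightarrow> nat \<Rightarrow> nat \<Rightarrow> nat \<Rightarrow> 'a)
      \<Rightarrow> ('o, 'm, 'a) simplex" where
  "simplex_of n x F E = (if n = 0 then Vertex (x 0) else Matrix (matrix_of n F E))"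

definition reindexed_simplex ::
    "nat \<Rightarrow> (nat \<Rightarrow> nat) \<Rightarrow> (nat \<Rightarrow> 'o) \<Rightarrow> (nat \<Rightarrow> nat \<Rightarrow> nat \<Rightarrow> 'm)
      \<Rightarrow> (nat \<Rightarrow> nat \<Rightarrow> nat \<Rightarrow> nat \<Rightarrow> 'a) \<Rightarrow> ('o, 'm, 'a) simplex" where
  "reindexed_simplex m \<theta> x F E = simplex_of m (\<lambda>i. x (\<theta> i))
     (\<lambda>i j k. F (\<theta> i) (\<theta> j) (\<theta> k)) (\<lambda>i j k l. E (\<theta> i) (\<theta> j) (\<theta> k) (\<theta> l))"

definition coface :: "nat \<Rightarrow> nat \<Rightarrow> nat" where
  "coface j i = (if i < j then i else i + 1)"

definition codegen :: "nat \<Rightarrow> nat \<Rightarrow> nat" where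
  "codegen j i = (if i \<le> j then i else i - 1)"

lemma mono_coface: "mono (coface j)"
  by (auto simp: mono_def coface_def)

lemma mono_codegen: "mono (codegen j)"
  by (auto simp: mono_def codegen_def)


section \<open>Faces and degeneracies as reindexing\<close>

context pasting_family
begin

lemma reindex:
  assumes "mono \<theta>" and "\<And>i. i \<le> m \<Longrightarrow> \<theta> i \<le> n"
  shows "pasting_family C A pull bd m (\<lambda>i. x (\<theta> i))
     (\<lambda>i j k. F (\<theta> i) (\<theta> j) (\<theta> k)) (\<lambda>i j k l. E (\<theta> i) (\<theta> j) (\<theta> k) (\<theta> l))"
proof -
  note le = monoD[OF assms(1)] assms(2)
  show ?thesis
    by unfold_locales
      (blast intro: le obj F_in F_Ident F_Comp E_in E_one E_vcomp E_target E_Ident E_hcomp)+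
qed

lemma simplex_of_in_nerve: "simplex_of n x F E \<in> nerve C A n"
proof (cases "n = 0")
  case True
  then show ?thesis
    using obj by (simp add: simplex_of_def nerve_def)
next
  case False
  have "matrix_of n F E \<in> nerve_matrices C A n"
    unfolding nerve_matrices_def mem_Collect_eq
    by (intro conjI exI[of _ x])
      (auto simp: matrix_of_def upper_triangular_def intro!: imageI obj F_in E_in)
  then show ?thesis
    using False by (simp add: simplex_of_def nerve_def)
qed

lemma vert_matrix_of:
  assumes "i \<le> n" and "0 < n"
  shows "vert C (matrix_of n F E) i = x i"
  using assms F_in[of 0 1 1] F_in[of "i - 1" i i]
  by (auto simp: vert_def matrix_of_def upper_triangular_def Hom_def)

text \<open>The product of consecutive entries of a row, which occurs in the definition of \<open>\<eta>\<^sub>k\<close>, is a vertical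
  composite.\<close>

lemma foldr_row:
  assumes "i \<le> j" and "j \<le> k" and "k \<le> l" and "l \<le> n"
  shows "foldr (\<otimes>\<^bsub>A (x j)\<^esub>) (map (\<lambda>r. E i j (r - 1) r) [k + 1..<l + 1]) \<one>\<^bsub>A (x j)\<^esub> = E i j k l"
  using assms(3,2)
proof (induction k rule: inc_induct)
  case base
  then show ?case
    using assms E_one by simp
next
  case (step k)
  then show ?case
    using assms E_vcomp[of i j k "Suc k" l] by (simp add: upt_conv_Cons del: upt_Suc)
qed

lemma eta_matrix_of:
  assumes "j < k" and "k \<le> n"
  shows "eta C A bd (matrix_of n F E) j k = F j (j + 1) k"
proof -
  have "map (\<lambda>l. elt (matrix_of n F E (j + 1) l)) [j + 2..<k + 1]
      = map (\<lambda>r. E j (j + 1) (r - 1) r) [j + 1 + 1..<k + 1]"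
    using assms by (auto simp: matrix_of_def upper_triangular_def)
  moreover have "mor (matrix_of n F E (j + 1) (j + 1)) = F j (j + 1) (j + 1)"
    using assms by (simp add: matrix_of_def upper_triangular_def)
  ultimately show ?thesis
    using assms vert_matrix_of[of "j + 1"] foldr_row[of j "j + 1" "j + 1" k]
      E_target[of j "j + 1" "j + 1" k]
    by (simp only: eta_def Let_def)
qed

text \<open>For \<open>0 < j < n\<close>, omitting the index \<open>j\<close> turns two adjacent steps into one of length two. In a row above \<open>j\<close> this
  concerns the stages \<open>j - 1, j, j + 1\<close>, so two entries are multiplied. Row \<open>j\<close> becomes the
  horizontal composite of the rows \<open>j\<close> and \<open>j + 1\<close>; its earliest stage is \<open>j + 1\<close>, whence the factor
  \<open>\<partial>(m\<^bsub>j,j+1\<^esub>)\<close> in the new diagonal entry.\<close>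

lemma face_simplex_of:
  assumes "1 \<le> n" and "j \<le> n"
  shows "face C A pull bd n j (simplex_of n x F E) = reindexed_simplex (n - 1) (coface j) x F E"
proof (cases "n = 1")
  case True
  then show ?thesis
    using assms F_in[of 0 1 1]
    by (auto simp: face_def reindexed_simplex_def simplex_of_def matrix_of_def
        upper_triangular_def coface_def Hom_def)
next
  case False
  let ?M = "matrix_of n F E"
  have "face_matrix C A pull bd n j ?M = matrix_of (n - 1)
     (\<lambda>i k l. F (coface j i) (coface j k) (coface j l))
     (\<lambda>i k l r. E (coface j i) (coface j k) (coface j l) (coface j r))"
    (is "?L = ?R")
  proof (intro ext)
    fix i k
    show "?L i k = ?R i k"
    proof (cases "1 \<le> i \<and> i \<le> k \<and> k \<le> n - 1")
      case ik: True
      consider "j = 0" | "j = n" | "0 < j" "j < n" "i < j" | "0 < j" "j < n" "i = j" "k = j"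
        | "0 < j" "j < n" "i = j" "j < k" | "0 < j" "j < n" "j < i"
        using assms ik by linarith
      then show ?thesis
      proof cases
        case 3
        show ?thesis
          using 3 ik E_vcomp[of "i - 1" i "j - 1" j "j + 1"]
          by (auto simp: face_matrix_def matrix_of_entry upper_triangular_def
              coface_def vert_matrix_of)
      next
        case 4
        have "F (j - 1) (j + 1) (j + 1) = Comp C (Comp C (F (j - 1) j j)
            (bd (x j) (E (j - 1) j j (j + 1)))) (F j (j + 1) (j + 1))"
          using 4 F_Comp[of "j - 1" j "j + 1" "j + 1"] E_target[of "j - 1" j j "j + 1"] by simp
        then show ?thesis
          using 4 ik by (simp add: face_matrix_def matrix_of_entry upper_triangular_def
              coface_def vert_matrix_of)
      next
        case 5
        have "E (j - 1) (j + 1) k (k + 1)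
            = pull (F j (j + 1) k) (E (j - 1) j k (k + 1)) \<otimes>\<^bsub>A (x (j + 1))\<^esub> E j (j + 1) k (k + 1)"
          using 5 ik by (intro E_hcomp) auto
        moreover have "k + 1 \<le> n"
          using 5 ik by linarith
        ultimately show ?thesis
          using 5 ik eta_matrix_of[of j k]
          by (auto simp: face_matrix_def matrix_of_entry upper_triangular_def
              coface_def vert_matrix_of)
      qed (use ik in \<open>auto simp: face_matrix_def matrix_of_def upper_triangular_def coface_def\<close>)
    qed (simp only: face_matrix_def matrix_of_def upper_triangular_def if_False)
  qed
  then show ?thesis
    using False assms by (simp add: face_def reindexed_simplex_def simplex_of_def)
qed

text \<open>Repeating the index \<open>j\<close> inserts an identity 2-cell in the rows up to \<open>j\<close>, and an identity
  1-cell with its identity 2-cells as row \<open>j + 1\<close>.\<close>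

lemma degen_simplex_of:
  assumes "j \<le> n"
  shows "degen C A n j (simplex_of n x F E) = reindexed_simplex (n + 1) (codegen j) x F E"
proof (cases "n = 0")
  case True
  then show ?thesis
    using assms F_Ident[of 0 0]
    by (auto simp: degen_def reindexed_simplex_def simplex_of_def matrix_of_def
        upper_triangular_def codegen_def fun_eq_iff le_Suc_eq)
next
  case False
  let ?M = "matrix_of n F E"
  have "degen_matrix C A n j ?M = matrix_of (n + 1)
     (\<lambda>i k l. F (codegen j i) (codegen j k) (codegen j l))
     (\<lambda>i k l r. E (codegen j i) (codegen j k) (codegen j l) (codegen j r))"
    (is "?L = ?R")
  proof (intro ext)
    fix i k
    show "?L i k = ?R i k"
    proof (cases "1 \<le> i \<and> i \<le> k \<and> k \<le> n + 1")
      case ik: True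
      consider "i \<le> j" "k \<le> j" | "i \<le> j" "k = j + 1" | "i \<le> j" "j + 1 < k"
        | "i = j + 1" "k = i" | "i = j + 1" "i < k" | "j + 1 < i"
        using ik by linarith
      then show ?thesis
      proof cases
        case 2
        then show ?thesis
          using assms ik False E_one[of "i - 1" i j]
          by (auto simp: degen_matrix_def matrix_of_entry upper_triangular_def codegen_def
              vert_matrix_of)
      next
        case 4
        then show ?thesis
          using assms ik False F_Ident[of j j]
          by (auto simp: degen_matrix_def matrix_of_entry upper_triangular_def codegen_def
              vert_matrix_of)
      next
        case 5
        then show ?thesis
          using assms ik False E_Ident[of j "k - 2" "k - 1"]
          by (auto simp: degen_matrix_def matrix_of_entry upper_triangular_def codegen_def
              vert_matrix_of numeral_2_eq_2)
      next
        case 1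
        then have "i - 1 \<le> j" "k - 1 \<le> j"
          by linarith+
        then show ?thesis
          using 1 assms ik
          by (simp add: degen_matrix_def matrix_of_entry upper_triangular_def codegen_def)
      next
        case 3
        define l where "l = k - 2"
        have l: "k = Suc (Suc l)" "j \<le> l" "i - 1 \<le> j"
          using 3 unfolding l_def by linarith+
        then show ?thesis
          using 3 ik by (simp add: degen_matrix_def matrix_of_entry upper_triangular_def codegen_def)
      next
        case 6
        define h l where "h = i - 2" and "l = k - 2"
        have "i = Suc (Suc h)" "k = Suc (Suc l)" "j \<le> h" "h \<le> l"
          using 6 ik unfolding h_def l_def by linarith+
        then show ?thesis
          using ik by (simp add: degen_matrix_def matrix_of_entry upper_triangular_def codegen_def)
      qed
    qed (simp only: degen_matrix_def matrix_of_def upper_triangular_def if_False)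
  qed
  then show ?thesis
    using False by (simp add: degen_def reindexed_simplex_def simplex_of_def)
qed

lemma face_reindexed:
  assumes "mono \<theta>" and "\<And>i. i \<le> m \<Longrightarrow> \<theta> i \<le> n" and "1 \<le> m" and "j \<le> m"
  shows "face C A pull bd m j (reindexed_simplex m \<theta> x F E)
    = reindexed_simplex (m - 1) (\<theta> \<circ> coface j) x F E"
  using pasting_family.face_simplex_of[OF reindex[OF assms(1,2)] assms(3,4)]
  by (simp add: reindexed_simplex_def)

lemma degen_reindexed:
  assumes "mono \<theta>" and "\<And>i. i \<le> m \<Longrightarrow> \<theta> i \<le> n" and "j \<le> m"
  shows "degen C A m j (reindexed_simplex m \<theta> x F E)
    = reindexed_simplex (m + 1) (\<theta> \<circ> codegen j) x F E"
  using pasting_family.degen_simplex_of[OF reindex[OF assms(1,2)] assms(3)]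
  by (simp add: reindexed_simplex_def)

lemma reindexed_in_nerve:
  assumes "mono \<theta>" and "\<And>i. i \<le> m \<Longrightarrow> \<theta> i \<le> n"
  shows "reindexed_simplex m \<theta> x F E \<in> nerve C A m"
  using pasting_family.simplex_of_in_nerve[OF reindex[OF assms]]
  by (simp add: reindexed_simplex_def)

lemma reindexed_id: "reindexed_simplex n id x F E = simplex_of n x F E"
  by (simp add: reindexed_simplex_def)

end


section \<open>Every simplex comes from a strict functor\<close>

text \<open>\<open>f i\<close> is the diagonal entry of row \<open>i\<close> and \<open>a i k\<close> its entry in column \<open>k\<close>.\<close>

locale matrix_rows = crossed_monoid C A pull bd
  for C :: "('o, 'm) category_data" and A :: "'o \<Rightarrow> 'a monoid"
    and pull :: "'m \<Rightarrow> 'a \<Rightarrow> 'a" and bd :: "'o \<Rightarrow> 'a \<Rightarrow> 'm" +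
  fixes n :: nat and x :: "nat \<Rightarrow> 'o" and f :: "nat \<Rightarrow> 'm" and a :: "nat \<Rightarrow> nat \<Rightarrow> 'a"
  assumes x_in: "i \<le> n \<Longrightarrow> x i \<in> Obj C"
    and f_in: "\<lbrakk>1 \<le> i; i \<le> n\<rbrakk> \<Longrightarrow> f i \<in> Hom C (x i) (x (i - 1))"
    and a_in: "\<lbrakk>1 \<le> i; i < k; k \<le> n\<rbrakk> \<Longrightarrow> a i k \<in> carrier (A (x i))"
begin

definition row_cell :: "nat \<Rightarrow> nat \<Rightarrow> nat \<Rightarrow> 'a" where
  "row_cell i k l = foldr (\<otimes>\<^bsub>A (x i)\<^esub>) (map (a i) [k + 1..<l + 1]) \<one>\<^bsub>A (x i)\<^esub>"

definition row_arrow :: "nat \<Rightarrow> nat \<Rightarrow> 'm" where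
  "row_arrow i k = Comp C (f i) (bd (x i) (row_cell i i k))"

text \<open>Row \<open>Suc h\<close> is composed on the right, so the recursion is on the upper index. For all \<open>h \<le> i\<close> the
  value is the identity, so that the recursion effectively starts at \<open>h = i\<close>.\<close>

primrec arrow :: "nat \<Rightarrow> nat \<Rightarrow> nat \<Rightarrow> 'm" where
  "arrow i 0 k = Ident C (x i)"
| "arrow i (Suc h) k =
     (if h < i then Ident C (x i) else Comp C (arrow i h k) (row_arrow (Suc h) k))"

primrec cell :: "nat \<Rightarrow> nat \<Rightarrow> nat \<Rightarrow> nat \<Rightarrow> 'a" where
  "cell i 0 k l = \<one>\<^bsub>A (x i)\<^esub>"
| "cell i (Suc h) k l =
     (if h < i then \<one>\<^bsub>A (x i)\<^esub>
      else pull (row_arrow (Suc h) k) (cell i h k l) \<otimes>\<^bsub>A (x (Suc h))\<^esub> row_cell (Suc h) k l)"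

lemma arrow_same: "arrow i i k = Ident C (x i)"
  by (cases i) auto

lemma cell_same: "cell i i k l = \<one>\<^bsub>A (x i)\<^esub>"
  by (cases i) auto

lemma row_cell_same: "row_cell i k k = \<one>\<^bsub>A (x i)\<^esub>"
  by (simp add: row_cell_def)

lemma row_cell_step: "k < l \<Longrightarrow> row_cell i k l = a i (Suc k) \<otimes>\<^bsub>A (x i)\<^esub> row_cell i (Suc k) l"
  by (simp add: row_cell_def upt_conv_Cons del: upt_Suc)

lemma row_cell_in:
  assumes "1 \<le> i" and "i \<le> k" and "k \<le> l" and "l \<le> n"
  shows "row_cell i k l \<in> carrier (A (x i))"
  using assms(3,2)
proof (induction k rule: inc_induct)
  case base
  then show ?case
    using assms by (simp add: row_cell_same one_closed x_in)
next
  case (step k)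
  then show ?case
    using assms by (simp add: row_cell_step mult_closed x_in a_in)
qed

lemma row_cell_vcomp:
  assumes "1 \<le> i" and "i \<le> k" and "k \<le> l" and "l \<le> r" and "r \<le> n"
  shows "row_cell i k r = row_cell i k l \<otimes>\<^bsub>A (x i)\<^esub> row_cell i l r"
  using assms(3,2)
proof (induction k rule: inc_induct)
  case base
  then show ?case
    using assms by (simp add: row_cell_same one_mult row_cell_in x_in)
next
  case (step k)
  then show ?case
    using assms by (simp add: row_cell_step mult_assoc x_in a_in row_cell_in)
qed

lemma row_arrow_in:
  assumes "1 \<le> i" and "i \<le> k" and "k \<le> n"
  shows "row_arrow i k \<in> Hom C (x i) (x (i - 1))"
  unfolding row_arrow_def
  using assms by (intro Comp_in[OF f_in bd_closed] x_in row_cell_in) auto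

lemma row_arrow_target:
  assumes "1 \<le> i" and "i \<le> k" and "k \<le> l" and "l \<le> n"
  shows "row_arrow i l = Comp C (row_arrow i k) (bd (x i) (row_cell i k l))"
proof -
  have x: "x i \<in> Obj C"
    using assms x_in by simp
  have c: "row_cell i i k \<in> carrier (A (x i))" "row_cell i k l \<in> carrier (A (x i))"
    using assms row_cell_in by auto
  have "row_cell i i l = row_cell i i k \<otimes>\<^bsub>A (x i)\<^esub> row_cell i k l"
    using row_cell_vcomp assms by blast
  then show ?thesis
    using Comp_assoc[OF f_in bd_closed[OF x c(1)] bd_closed[OF x c(2)]] assms
    by (simp add: row_arrow_def bd_mult[OF x c])
qed

lemma arrow_in:
  assumes "i \<le> h" and "h \<le> k" and "k \<le> n"
  shows "arrow i h k \<in> Hom C (x h) (x i)"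
  using assms
proof (induction h rule: dec_induct)
  case base
  then show ?case
    by (simp add: arrow_same Ident_in x_in)
next
  case (step h)
  then show ?case
    using Comp_in[of "arrow i h k" "x h" "x i"] row_arrow_in[of "Suc h" k] by simp
qed

lemma cell_in:
  assumes "i \<le> h" and "h \<le> k" and "k \<le> l" and "l \<le> n"
  shows "cell i h k l \<in> carrier (A (x h))"
  using assms
proof (induction h rule: dec_induct)
  case base
  then show ?case
    by (simp add: cell_same one_closed x_in)
next
  case (step h)
  then show ?case
    using pull_closed[OF row_arrow_in[of "Suc h" k]] by (simp add: mult_closed x_in row_cell_in)
qed

lemma arrow_Comp:
  assumes "i \<le> j" and "j \<le> h" and "h \<le> k" and "k \<le> n"
  shows "arrow i h k = Comp C (arrow i j k) (arrow j h k)"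
  using assms(2,3)
proof (induction h rule: dec_induct)
  case base
  then show ?case
    using assms Comp_Ident[OF arrow_in[of i j k]] by (simp add: arrow_same)
next
  case (step h)
  then show ?case
    using assms Comp_assoc[OF arrow_in[of i j k] arrow_in[of j h k], of "row_arrow (Suc h) k"]
      row_arrow_in[of "Suc h" k] by simp
qed

lemma cell_one:
  assumes "i \<le> h" and "h \<le> k" and "k \<le> n"
  shows "cell i h k k = \<one>\<^bsub>A (x h)\<^esub>"
  using assms
proof (induction h rule: dec_induct)
  case base
  then show ?case
    by (simp add: cell_same)
next
  case (step h)
  then show ?case
    using pull_one[OF row_arrow_in[of "Suc h" k]]
    by (simp add: row_cell_same one_mult one_closed x_in)
qed

text \<open>Horizontal composites compose vertically: in the step, the interchange law combines the induction
  hypothesis with the vertical composition in row \<open>Suc h\<close>.\<close>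

lemma cell_vcomp:
  assumes "i \<le> h" and "h \<le> k" and "k \<le> l" and "l \<le> r" and "r \<le> n"
  shows "cell i h k r = cell i h k l \<otimes>\<^bsub>A (x h)\<^esub> cell i h l r"
  using assms
proof (induction h rule: dec_induct)
  case base
  then show ?case
    by (simp add: cell_same one_mult one_closed x_in)
next
  case (step h)
  then show ?case
    using interchange[of "row_arrow (Suc h) k" "x (Suc h)" "x h" "cell i h k l" "cell i h l r"
        "row_cell (Suc h) k l" "row_cell (Suc h) l r"]
      row_arrow_in[of "Suc h" k] row_arrow_target[of "Suc h" k l] row_cell_vcomp[of "Suc h" k l r]
    by (simp add: cell_in row_cell_in)
qed

lemma cell_target:
  assumes "i \<le> h" and "h \<le> k" and "k \<le> l" and "l \<le> n"
  shows "arrow i h l = Comp C (arrow i h k) (bd (x h) (cell i h k l))"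
  using assms
proof (induction h rule: dec_induct)
  case base
  then show ?case
    using Comp_Ident[OF Ident_in[of "x i"]] by (simp add: arrow_same cell_same bd_one x_in)
next
  case (step h)
  then show ?case
    using hcomp_target[OF arrow_in[of i h k], of "row_arrow (Suc h) k" "x (Suc h)" "cell i h k l"
        "row_cell (Suc h) k l"]
      row_arrow_in[of "Suc h" k] row_arrow_target[of "Suc h" k l]
    by (simp add: cell_in row_cell_in)
qed

lemma cell_hcomp:
  assumes "i \<le> j" and "j \<le> h" and "h \<le> k" and "k \<le> l" and "l \<le> n"
  shows "cell i h k l = pull (arrow j h k) (cell i j k l) \<otimes>\<^bsub>A (x h)\<^esub> cell j h k l"
  using assms(2,3)
proof (induction h rule: dec_induct)
  case base
  then show ?case
    using assms cell_in[of i j k l] by (simp add: arrow_same cell_same pull_Ident mult_one x_in)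
next
  case (step h)
  define c where "c = pull (arrow j h k) (cell i j k l)"
  have c: "c \<in> carrier (A (x h))"
    unfolding c_def using pull_closed[OF arrow_in cell_in] step assms by simp
  have p: "row_arrow (Suc h) k \<in> Hom C (x (Suc h)) (x h)"
    using row_arrow_in[of "Suc h" k] step assms by simp
  have d: "cell j h k l \<in> carrier (A (x h))"
    using cell_in step assms by simp
  have "pull (arrow j (Suc h) k) (cell i j k l) = pull (row_arrow (Suc h) k) c"
    unfolding c_def using pull_Comp[OF arrow_in[of j h k] p cell_in[of i j k l]] step assms by simp
  then show ?case
    using step assms pull_mult[OF p c d] pull_closed[OF p c] pull_closed[OF p d]
    by (simp add: c_def[symmetric] mult_assoc x_in row_cell_in)
qed

lemma pasting_family: "pasting_family C A pull bd n x arrow cell"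
  by unfold_locales
    (rule x_in arrow_in arrow_same arrow_Comp cell_in cell_one cell_vcomp cell_target cell_same
      cell_hcomp; assumption)+

lemma arrow_diagonal:
  assumes "1 \<le> i" and "i \<le> n"
  shows "arrow (i - 1) i i = f i"
proof -
  have x: "x (i - 1) \<in> Obj C" "x i \<in> Obj C"
    using assms x_in by auto
  have "row_arrow i i = f i"
    using Comp_Ident[OF f_in] assms by (simp add: row_arrow_def row_cell_same bd_one x)
  moreover have "arrow (i - 1) i i = Comp C (Ident C (x (i - 1))) (row_arrow i i)"
    using assms by (cases i) (auto simp: arrow_same)
  ultimately show ?thesis
    using Ident_Comp[OF f_in] assms by simp
qed

lemma cell_entry:
  assumes "1 \<le> i" and "i < k" and "k \<le> n"
  shows "cell (i - 1) i (k - 1) k = a i k"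
proof -
  have "cell (i - 1) i (k - 1) k
      = pull (row_arrow i (k - 1)) \<one>\<^bsub>A (x (i - 1))\<^esub> \<otimes>\<^bsub>A (x i)\<^esub> row_cell i (k - 1) k"
    using assms by (cases i) (auto simp: cell_same)
  then show ?thesis
    using assms pull_one[OF row_arrow_in[of i "k - 1"]] row_cell_step[of "k - 1" k i]
    by (simp add: row_cell_same one_mult mult_one a_in x_in)
qed

end

context crossed_monoid
begin

text \<open>The unfolding of a simplex into a pasting family. A vertex has no rows, so there any values serve as
  entries.\<close>

lemma nerve_cases:
  assumes "X \<in> nerve C A n"
  obtains x F E where "pasting_family C A pull bd n x F E" and "X = simplex_of n x F E"
proof (cases "n = 0")
  case True
  then obtain p where p: "p \<in> Obj C" "X = Vertex p"
    using assms by (auto simp: nerve_def)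
  interpret matrix_rows C A pull bd 0 "\<lambda>_. p" "\<lambda>_. undefined" "\<lambda>_ _. undefined"
    using p by unfold_locales auto
  show ?thesis
    using that pasting_family p True by (simp add: simplex_of_def)
next
  case False
  then obtain m where m: "m \<in> nerve_matrices C A n" and X: "X = Matrix m"
    using assms by (auto simp: nerve_def)
  from m obtain x where
    absent: "\<And>i j. \<not> (1 \<le> i \<and> i \<le> j \<and> j \<le> n) \<Longrightarrow> m i j = Absent"
    and x: "\<And>j. j \<le> n \<Longrightarrow> x j \<in> Obj C"
    and diag: "\<And>j. 1 \<le> j \<Longrightarrow> j \<le> n \<Longrightarrow> m j j \<in> Mor ` Hom C (x j) (x (j - 1))"
    and off: "\<And>i j. 1 \<le> i \<Longrightarrow> i < j \<Longrightarrow> j \<le> n \<Longrightarrow> m i j \<in> Elt ` carrier (A (x i))"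
    unfolding nerve_matrices_def by blast
  interpret matrix_rows C A pull bd n x "\<lambda>i. mor (m i i)" "\<lambda>i k. elt (m i k)"
  proof unfold_locales
    show "mor (m i i) \<in> Hom C (x i) (x (i - 1))" if "1 \<le> i" "i \<le> n" for i
      using diag[OF that] by auto
    show "elt (m i k) \<in> carrier (A (x i))" if "1 \<le> i" "i < k" "k \<le> n" for i k
      using off[OF that] by auto
  qed (rule x)
  have "m i k = matrix_of n arrow cell i k" for i k
  proof -
    consider "\<not> (1 \<le> i \<and> i \<le> k \<and> k \<le> n)" | "1 \<le> i" "i = k" "k \<le> n" | "1 \<le> i" "i < k" "k \<le> n"
      by linarith
    then show ?thesis
    proof cases
      case 1
      then show ?thesis
        using absent by (auto simp: matrix_of_def upper_triangular_def)
    next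
      case 2
      then show ?thesis
        using diag[of i] arrow_diagonal[of i] by (auto simp: matrix_of_entry)
    next
      case 3
      then show ?thesis
        using off[of i k] cell_entry[of i k] by (auto simp: matrix_of_entry)
    qed
  qed
  then have "m = matrix_of n arrow cell"
    by (intro ext)
  then have "X = simplex_of n x arrow cell"
    using False X by (simp add: simplex_of_def)
  then show ?thesis
    using that pasting_family by blast
qed

end


section \<open>The simplicial identities\<close>

theorem theorem3p2:
  fixes C :: "('o, 'm) category_data"
    and A :: "'o \<Rightarrow> 'a monoid"
    and pull :: "'m \<Rightarrow> 'a \<Rightarrow> 'a"
    and bd :: "'o \<Rightarrow> 'a \<Rightarrow> 'm"
  assumes "crossed_monoid C A pull bd"
  shows "simplicial_set (nerve C A) (face C A pull bd) (degen C A)"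
proof -
  interpret crossed_monoid C A pull bd
    by (rule assms)
  have cosimplicial:
    "i < j \<Longrightarrow> coface j \<circ> coface i = coface i \<circ> coface (j - 1)"
    "i < j \<Longrightarrow> codegen j \<circ> coface i = coface i \<circ> codegen (j - 1)"
    "codegen j \<circ> coface j = id"
    "codegen j \<circ> coface (j + 1) = id"
    "j + 1 < i \<Longrightarrow> codegen j \<circ> coface i = coface (i - 1) \<circ> codegen j"
    "i \<le> j \<Longrightarrow> codegen j \<circ> codegen i = codegen i \<circ> codegen (j + 1)" for i j
    by (auto simp: fun_eq_iff coface_def codegen_def)
  have coface_le: "coface j i \<le> n" if "1 \<le> n" "i \<le> n - 1" for i j n
    using that by (auto simp: coface_def)
  have codegen_le: "codegen j i \<le> n" if "j \<le> n" "i \<le> n + 1" for i j n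
    using that by (auto simp: codegen_def)
  show ?thesis
  proof
    fix n j and X :: "('o, 'm, 'a) simplex"
    assume h: "1 \<le> n" "j \<le> n" and X: "X \<in> nerve C A n"
    from X obtain x F E where fam: "pasting_family C A pull bd n x F E" "X = simplex_of n x F E"
      by (rule nerve_cases)
    interpret pasting_family C A pull bd n x F E by (rule fam)
    show "face C A pull bd n j X \<in> nerve C A (n - 1)"
      using h by (simp add: fam(2) face_simplex_of reindexed_in_nerve mono_coface coface_le)
  next
    fix n j and X :: "('o, 'm, 'a) simplex"
    assume h: "j \<le> n" and X: "X \<in> nerve C A n"
    from X obtain x F E where fam: "pasting_family C A pull bd n x F E" "X = simplex_of n x F E"
      by (rule nerve_cases)
    interpret pasting_family C A pull bd n x F E by (rule fam)
    show "degen C A n j X \<in> nerve C A (n + 1)"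
      using h reindexed_in_nerve[OF mono_codegen codegen_le[OF h]]
      by (simp add: fam(2) degen_simplex_of)
    have "face C A pull bd (n + 1) i (degen C A n j X)
        = reindexed_simplex n (codegen j \<circ> coface i) x F E" if "i \<le> n + 1" for i
      using h that face_reindexed[OF mono_codegen codegen_le[OF h], where j = i]
      by (simp add: fam(2) degen_simplex_of)
    then show "face C A pull bd (n + 1) j (degen C A n j X) = X"
      and "face C A pull bd (n + 1) (j + 1) (degen C A n j X) = X"
      using h by (simp_all only: cosimplicial reindexed_id fam(2) add_le_mono1 le_add1 trans_le_add1)
  next
    fix n i j and X :: "('o, 'm, 'a) simplex"
    assume h: "2 \<le> n" "i < j" "j \<le> n" and X: "X \<in> nerve C A n"
    from X obtain x F E where fam: "pasting_family C A pull bd n x F E" "X = simplex_of n x F E"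
      by (rule nerve_cases)
    interpret pasting_family C A pull bd n x F E by (rule fam)
    have n: "1 \<le> n" using h by simp
    note * = face_reindexed[OF mono_coface coface_le[OF n]]
    show "face C A pull bd (n - 1) i (face C A pull bd n j X)
        = face C A pull bd (n - 1) (j - 1) (face C A pull bd n i X)"
      using h by (simp add: fam(2) face_simplex_of * cosimplicial(1))
  next
    fix n i j and X :: "('o, 'm, 'a) simplex"
    assume h: "i < j" "j \<le> n" and X: "X \<in> nerve C A n"
    from X obtain x F E where fam: "pasting_family C A pull bd n x F E" "X = simplex_of n x F E"
      by (rule nerve_cases)
    interpret pasting_family C A pull bd n x F E by (rule fam)
    have n: "1 \<le> n" using h by simp
    show "face C A pull bd (n + 1) i (degen C A n j X)
        = degen C A (n - 1) (j - 1) (face C A pull bd n i X)"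
      using h face_reindexed[OF mono_codegen codegen_le[OF h(2)], where j = i]
        degen_reindexed[OF mono_coface coface_le[OF n], where j = "j - 1"]
      by (simp add: fam(2) face_simplex_of degen_simplex_of cosimplicial(2))
  next
    fix n i j and X :: "('o, 'm, 'a) simplex"
    assume h: "j + 1 < i" "i \<le> n + 1" and X: "X \<in> nerve C A n"
    from X obtain x F E where fam: "pasting_family C A pull bd n x F E" "X = simplex_of n x F E"
      by (rule nerve_cases)
    interpret pasting_family C A pull bd n x F E by (rule fam)
    have n: "1 \<le> n" and j: "j \<le> n" using h by auto
    show "face C A pull bd (n + 1) i (degen C A n j X)
        = degen C A (n - 1) j (face C A pull bd n (i - 1) X)"
      using h n j face_reindexed[OF mono_codegen codegen_le[OF j], where j = i]
        degen_reindexed[OF mono_coface coface_le[OF n], where j = j]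
      by (simp add: fam(2) face_simplex_of degen_simplex_of cosimplicial(5))
  next
    fix n i j and X :: "('o, 'm, 'a) simplex"
    assume h: "i \<le> j" "j \<le> n" and X: "X \<in> nerve C A n"
    from X obtain x F E where fam: "pasting_family C A pull bd n x F E" "X = simplex_of n x F E"
      by (rule nerve_cases)
    interpret pasting_family C A pull bd n x F E by (rule fam)
    have i: "i \<le> n" using h by simp
    show "degen C A (n + 1) i (degen C A n j X) = degen C A (n + 1) (j + 1) (degen C A n i X)"
      using h i degen_reindexed[OF mono_codegen codegen_le[OF h(2)], where j = i]
        degen_reindexed[OF mono_codegen codegen_le[OF i], where j = "j + 1"]
      by (simp add: fam(2) degen_simplex_of cosimplicial(6))
  qed
qed

end
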